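(* Let $m\ge 3$ be an integer and let $G$ be a multigraph with $m$ edges that has the maximum number of cycles among all multigraphs with $m$ edges. Then $$\tfrac{9}{10}(\sqrt[3]{3})^m<4(\sqrt[3]{3})^{m-4}\le C(G)\le 8.25\,(\sqrt[3]{3})^m.$$
   Context: Multigraphs are finite (with any number of vertices), may have parallel edges, and have no loops. Parallel edges are counted separately in the number of edges. A cycle in a multigraph $G$ is a set of $k\ge 2$ distinct vertices and $k$ distinct edges $\{v_1,e_1,v_2,e_2,\dots,v_k,e_k\}$ such that $e_i$ joins $v_i$ and $v_{i+1}$ for $1\le i<k$ and $e_k$ joins $v_k$ and $v_1$ (so two parallel edges together with their two endpoints form a cycle; choice of starting point and direction is irrelevant). $C(G)$ denotes the number of cycles in $G$. *)

theory Defs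
  imports Complex_Main
begin

text \<open>
  Edges are objects of their own, so that parallel edges are counted separately;
  \<open>ends G e\<close> is the set of the endpoints of the edge \<open>e\<close>.
\<close>

record ('v, 'e) multigraph =
  verts :: "'v set"
  edges :: "'e set"
  ends :: "'e \<Rightarrow> 'v set"

text \<open>The requirement \<open>card (ends G e) = 2\<close> excludes loops.\<close>

definition is_multigraph :: "('v, 'e) multigraph \<Rightarrow> bool" where
  "is_multigraph G \<longleftrightarrow>
     finite (verts G) \<and> finite (edges G) \<and>
     (\<forall>e\<in>edges G. ends G e \<subseteq> verts G \<and> card (ends G e) = 2)"

definition is_cycle_seq :: "('v, 'e) multigraph \<Rightarrow> 'v list \<Rightarrow> 'e list \<Rightarrow> bool" where
  "is_cycle_seq G vs es \<longleftrightarrow>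
     length vs \<ge> 2 \<and> length es = length vs \<and>
     distinct vs \<and> distinct es \<and>
     set vs \<subseteq> verts G \<and> set es \<subseteq> edges G \<and>
     (\<forall>i<length vs. ends G (es ! i) = {vs ! i, vs ! (Suc i mod length vs)})"

text \<open>
  A cycle is the set of the vertices and edges occurring in such a sequence, kept as the
  pair of its vertex set and its edge set; the starting point and the direction are
  thereby forgotten.
\<close>

definition cycles :: "('v, 'e) multigraph \<Rightarrow> ('v set \<times> 'e set) set" where
  "cycles G = {(set vs, set es) | vs es. is_cycle_seq G vs es}"

definition num_cycles :: "('v, 'e) multigraph \<Rightarrow> nat" where
  "num_cycles G = card (cycles G)"

text \<open>
  HOL cannot quantify over types inside a formula, so the competitors \<open>H\<close> range over the
  multigraphs with natural numbers as vertices and edges. Every finite multigraph is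
  isomorphic to one of these, while \<open>G\<close> itself may live on arbitrary types.
\<close>

definition max_cycles :: "nat \<Rightarrow> ('v, 'e) multigraph \<Rightarrow> bool" where
  "max_cycles m G \<longleftrightarrow>
     is_multigraph G \<and> card (edges G) = m \<and>
     (\<forall>H :: (nat, nat) multigraph.
        is_multigraph H \<and> card (edges H) = m \<longrightarrow> num_cycles H \<le> num_cycles G)"

end

theory Submission
  imports Defs "HOL-Library.FuncSet"
begin

text \<open>
  Let \<open>r\<close> be the cube root of 3, so that \<open>d \<le> r ^ d\<close> for every natural number \<open>d\<close>.
  If \<open>u \<noteq> v\<close> and \<open>u\<close> has degree \<open>d\<close>, a path from \<open>u\<close> to \<open>v\<close> consists of one of the \<open>d\<close> edges
  at \<open>u\<close> and a path in the multigraph without \<open>u\<close>; by induction there are at most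
  \<open>d * r ^ (m - d) \<le> r ^ m\<close> such paths. A cycle is an edge together with a path between its
  endpoints that avoids it, so adding an edge to a multigraph with \<open>i\<close> edges creates at most
  \<open>2 * r ^ i\<close> cycles (a factor 2 is lost because the direction of the path is not controlled),
  and the geometric series gives \<open>2 / (r - 1) * r ^ m\<close>.
  The lower bound comes from a cycle whose edges are replaced by bundles of three parallel
  edges, one bundle having size 2, 3 or 4 to adjust the number of edges to \<open>m\<close>; this needs at
  least two bundles, so for \<open>m\<close> = 3 and 4 all edges are put between two vertices instead.
\<close>

subsection \<open>The cube root of 3\<close>

lemma root_3_3_cubed: "root 3 3 ^ 3 = 3"
  by simp

lemma root_3_3_ge: "1.44 \<le> root 3 3"
proof -
  have "root 3 (1.44 ^ 3) \<le> root 3 3"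
    by (intro real_root_le_mono) (auto simp: power3_eq_cube)
  then show ?thesis
    by (simp add: real_root_power_cancel)
qed

lemma root_3_3_le: "root 3 3 \<le> 1.45"
proof -
  have "root 3 3 \<le> root 3 (1.45 ^ 3)"
    by (intro real_root_le_mono) (auto simp: power3_eq_cube)
  then show ?thesis
    by (simp add: real_root_power_cancel)
qed

text \<open>Equality holds at \<open>d = 3\<close>, where \<open>d\<close> to the power
  \<open>1 / d\<close> is largest among natural numbers; this is why the base is the cube root of
  3.\<close>

lemma of_nat_le_root_3_3_power: "real d \<le> root 3 3 ^ d"
proof (cases "d < 3")
  case True
  have "1.44 * 1.44 \<le> root 3 3 * root 3 3"
    using root_3_3_ge by (intro mult_mono) auto
  moreover from True have "d = 0 \<or> d = 1 \<or> d = 2"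
    by auto
  ultimately show ?thesis
    using root_3_3_ge by (auto simp: power2_eq_square)
next
  case False
  then have "3 \<le> d"
    by simp
  then show ?thesis
  proof (induction d rule: dec_induct)
    case base
    then show ?case
      by simp
  next
    case (step d)
    \<comment> \<open>From \<open>d = 3\<close> on, \<open>(d + 1) / d\<close> is at most 4/3, below
      1.44.\<close>
    have "real (Suc d) \<le> 1.44 * real d"
      using step.hyps by simp
    also have "\<dots> \<le> root 3 3 * root 3 3 ^ d"
      using step.IH root_3_3_ge by (intro mult_mono) auto
    finally show ?case
      by simp
  qed
qed

subsection \<open>Counting paths\<close>

text \<open>Only the edge set of a path is recorded.\<close>

inductive is_path :: "('e \<Rightarrow> 'v set) \<Rightarrow> 'e set \<Rightarrow> 'v \<Rightarrow> 'v \<Rightarrow> 'e set \<Rightarrow> bool" for en where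
  Nil: "is_path en F u u {}"
| Step: "\<lbrakk>e \<in> F; en e = {u, w}; u \<noteq> v; is_path en {f \<in> F. u \<notin> en f} w v P\<rbrakk>
    \<Longrightarrow> is_path en F u v (insert e P)"

text \<open>All edges at \<open>u\<close> are deleted at once, hence strong induction on
  \<open>F\<close>; the start varies while the target \<open>v\<close> stays fixed. Finiteness is
  carried along because \<open>card\<close> of an infinite set is 0.\<close>

lemma card_paths_le:
  assumes "finite F"
  shows "finite {P. is_path en F u v P} \<and> real (card {P. is_path en F u v P}) \<le> root 3 3 ^ card F"
  using assms
proof (induction F arbitrary: u rule: finite_psubset_induct)
  case (psubset F)
  note r = root_3_3_ge
  show ?case
  proof (cases "u = v")
    case True
    then have "{P. is_path en F u v P} = {{}}"
      by (auto intro: is_path.intros elim: is_path.cases)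
    then show ?thesis
      using r by (simp add: one_le_power)
  next
    case False
    define D where "D = {f \<in> F. u \<in> en f}"
    define F' where "F' = {f \<in> F. u \<notin> en f}"
    \<comment> \<open>\<open>g e\<close> is the other end of \<open>e\<close>. If
      \<open>en e\<close> does not have the form \<open>{u, w}\<close>, its value is arbitrary,
      which can only enlarge the upper bound \<open>S\<close>.\<close>
    define g where "g e = (SOME w. en e = {u, w})" for e
    define S where "S = (\<Union>e\<in>D. insert e ` {P. is_path en F' (g e) v P})"
    have sub: "{P. is_path en F u v P} \<subseteq> S"
    proof
      fix P assume "P \<in> {P. is_path en F u v P}"
      then have "is_path en F u v P"
        by simp
      then show "P \<in> S"
      proof cases
        case Nil
        with False show ?thesis
          by simp
      next
        case (Step e w Q)
        then have "en e = {u, g e}"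
          unfolding g_def by (metis (mono_tags, lifting) someI)
        with Step have "g e = w"
          by (auto simp: doubleton_eq_iff)
        with Step show ?thesis
          unfolding S_def D_def F'_def by auto
      qed
    qed
    have finD: "finite D" "finite F'"
      using psubset.hyps by (auto simp: D_def F'_def)
    show ?thesis
    proof (cases "D = {}")
      case True
      with sub have "{P. is_path en F u v P} = {}"
        by (simp add: S_def)
      then show ?thesis
        using r by simp
    next
      case ne: False
      then have "F' \<subset> F"
        by (auto simp: D_def F'_def)
      then have IH: "finite {P. is_path en F' w v P}"
          "real (card {P. is_path en F' w v P}) \<le> root 3 3 ^ card F'" for w
        using psubset.IH by auto
      have finS: "finite S"
        unfolding S_def using finD IH by auto
      have "card S \<le> (\<Sum>e\<in>D. card (insert e ` {P. is_path en F' (g e) v P}))"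
        unfolding S_def by (rule card_UN_le[OF finD(1)])
      also have "\<dots> \<le> (\<Sum>e\<in>D. card {P. is_path en F' (g e) v P})"
        by (intro sum_mono card_image_le IH)
      finally have "real (card S) \<le> (\<Sum>e\<in>D. real (card {P. is_path en F' (g e) v P}))"
        by (metis of_nat_le_iff of_nat_sum)
      also have "\<dots> \<le> (\<Sum>e\<in>D. root 3 3 ^ card F')"
        by (intro sum_mono IH)
      also have "\<dots> = real (card D) * root 3 3 ^ card F'"
        by simp
      also have "\<dots> \<le> root 3 3 ^ card D * root 3 3 ^ card F'"
        using r by (intro mult_right_mono of_nat_le_root_3_3_power) auto
      also have "\<dots> = root 3 3 ^ card F"
      proof -
        have "F = D \<union> F'" "D \<inter> F' = {}"
          by (auto simp: D_def F'_def)
        then show ?thesis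
          using finD by (metis card_Un_disjoint power_add)
      qed
      finally have "real (card S) \<le> root 3 3 ^ card F" .
      with sub finS show ?thesis
        by (meson card_mono finite_subset of_nat_mono order_trans)
    qed
  qed
qed

lemma is_path_of_lists:
  assumes "distinct vs" "distinct es" "length vs = Suc (length es)" "set es \<subseteq> F"
    and "\<And>i. i < length es \<Longrightarrow> en (es ! i) = {vs ! i, vs ! Suc i}"
  shows "is_path en F (hd vs) (last vs) (set es)"
  using assms
proof (induction es arbitrary: vs F)
  case Nil
  then obtain v where "vs = [v]"
    by (auto simp: length_Suc_conv)
  then show ?case
    by (auto intro: is_path.intros)
next
  case (Cons e es)
  then obtain u ws where vs: "vs = u # ws" "length ws = Suc (length es)"
    by (cases vs) auto
  then have ne: "ws \<noteq> []"
    by auto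
  have ends: "en (es ! i) = {ws ! i, ws ! Suc i}" if "i < length es" for i
    using Cons.prems(5)[of "Suc i"] that vs by simp
  \<comment> \<open>The later edges join vertices of \<open>ws\<close>, which misses
    \<open>u\<close> by distinctness, so they survive the deletion of the edges at
    \<open>u\<close>.\<close>
  have "set es \<subseteq> {f \<in> F. u \<notin> en f}"
  proof
    fix f assume f: "f \<in> set es"
    then obtain i where i: "i < length es" "f = es ! i"
      by (auto simp: in_set_conv_nth)
    then have "en f \<subseteq> set ws"
      using ends vs by auto
    then show "f \<in> {f \<in> F. u \<notin> en f}"
      using f Cons.prems vs by auto
  qed
  then have "is_path en {f \<in> F. u \<notin> en f} (hd ws) (last ws) (set es)"
    using Cons.prems vs ends by (intro Cons.IH) auto
  moreover have "en e = {u, hd ws}"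
    using Cons.prems(5)[of 0] vs ne by (simp add: hd_conv_nth)
  moreover have "u \<noteq> last ws"
    using Cons.prems(1) vs ne by auto
  ultimately show ?case
    using Cons.prems(4) vs ne by (auto intro: is_path.Step)
qed

subsection \<open>Counting cycles\<close>

lemma is_cycle_seq_rotate:
  assumes "is_cycle_seq G vs es"
  shows "is_cycle_seq G (rotate n vs) (rotate n es)"
proof -
  have k: "length vs \<ge> 2" "length es = length vs"
    and ends: "\<And>i. i < length vs \<Longrightarrow> ends G (es ! i) = {vs ! i, vs ! (Suc i mod length vs)}"
    using assms by (auto simp: is_cycle_seq_def)
  have "ends G (rotate n es ! i) = {rotate n vs ! i, rotate n vs ! (Suc i mod length vs)}"
    if i: "i < length vs" for i
  proof -
    have "0 < length vs"
      using i by linarith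
    then have "(n + i) mod length vs < length vs" "Suc i mod length vs < length vs"
      by (simp_all only: mod_less_divisor)
    then show ?thesis
      using ends i k by (simp add: nth_rotate mod_simps)
  qed
  then show ?thesis
    using assms by (auto simp: is_cycle_seq_def)
qed

text \<open>Rotate the cycle until \<open>e\<close> is its closing edge; the other edges then form a
  path. The ends of \<open>e\<close> are unordered, hence the disjunction.\<close>

lemma cycle_minus_edge_is_path:
  assumes "is_cycle_seq G vs es" "e \<in> set es" "set es \<subseteq> insert e F" "ends G e = {u, v}"
  shows "\<exists>P. set es = insert e P \<and> (is_path (ends G) F u v P \<or> is_path (ends G) F v u P)"
proof -
  obtain j where j: "j < length es" "es ! j = e"
    using assms(2) by (auto simp: in_set_conv_nth)
  \<comment> \<open>Rotating by \<open>Suc j\<close> moves position \<open>j\<close> to the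
    end.\<close>
  define ws where "ws = rotate (Suc j) vs"
  define fs where "fs = rotate (Suc j) es"
  have cyc: "is_cycle_seq G ws fs"
    unfolding ws_def fs_def by (rule is_cycle_seq_rotate[OF assms(1)])
  then have k: "length ws \<ge> 2" "length fs = length ws" "distinct ws" "distinct fs"
    and ends: "\<And>i. i < length ws \<Longrightarrow> ends G (fs ! i) = {ws ! i, ws ! (Suc i mod length ws)}"
    by (auto simp: is_cycle_seq_def)
  have ne: "fs \<noteq> []" "ws \<noteq> []"
    using k by auto
  have len: "length fs = length es"
    by (simp add: fs_def)
  have last: "last fs = e"
    using j ne len by (simp add: last_conv_nth fs_def nth_rotate del: rotate_Suc)
  then have fs: "fs = butlast fs @ [e]"
    using ne by (metis append_butlast_last_id)
  then have "distinct (butlast fs @ [e])"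
    using k(4) by simp
  then have notin: "e \<notin> set (butlast fs)"
    by simp
  have "set fs = set (butlast fs @ [e])"
    using fs by (rule arg_cong)
  then have set: "set es = insert e (set (butlast fs))"
    by (simp add: fs_def del: rotate_Suc)
  have "is_path (ends G) F (hd ws) (last ws) (set (butlast fs))"
  proof (rule is_path_of_lists)
    show "set (butlast fs) \<subseteq> F"
      using notin set assms(3) by auto
    show "ends G (butlast fs ! i) = {ws ! i, ws ! Suc i}" if "i < length (butlast fs)" for i
      using ends[of i] that k by (simp add: nth_butlast)
  qed (use k in \<open>auto simp: distinct_butlast\<close>)
  moreover have "ends G e = {hd ws, last ws}"
  proof -
    have "Suc (length ws - 1) = length ws"
      using k(1) by simp
    then have "ends G (fs ! (length ws - 1)) = {ws ! (length ws - 1), ws ! 0}"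
      using ends[of "length ws - 1"] by (metis lessI mod_self)
    then show ?thesis
      using last ne k by (auto simp: last_conv_nth hd_conv_nth)
  qed
  ultimately show ?thesis
    using set assms(4) by (auto simp: doubleton_eq_iff)
qed

text \<open>Restricting the edges to \<open>F\<close> while keeping \<open>G\<close> allows
  induction on \<open>F\<close> without forming subgraphs.\<close>

definition cycle_edge_sets :: "('v, 'e) multigraph \<Rightarrow> 'e set \<Rightarrow> 'e set set" where
  "cycle_edge_sets G F = {set es | vs es. is_cycle_seq G vs es \<and> set es \<subseteq> F}"

text \<open>Each cycle is charged to the last of its edges to be added; the others form a path in
  the edges already present.\<close>

lemma card_cycle_edge_sets_le:
  assumes "is_multigraph G" "F \<subseteq> edges G"
  shows "real (card (cycle_edge_sets G F)) \<le> 2 * (\<Sum>i<card F. root 3 3 ^ i)"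
proof -
  have "finite F"
    using assms finite_subset by (auto simp: is_multigraph_def)
  then show ?thesis
    using assms(2)
  proof (induction F rule: finite_induct)
    case empty
    have "cycle_edge_sets G {} = {}"
      by (auto simp: cycle_edge_sets_def is_cycle_seq_def)
    then show ?case
      by simp
  next
    case (insert e F)
    have "card (ends G e) = 2"
      using insert.prems assms(1) by (auto simp: is_multigraph_def)
    then obtain u v where uv: "ends G e = {u, v}"
      by (auto simp: card_2_iff)
    let ?P = "\<lambda>u v. {P. is_path (ends G) F u v P}"
    let ?S = "cycle_edge_sets G F \<union> (insert e ` ?P u v \<union> insert e ` ?P v u)"
    have sub: "cycle_edge_sets G (insert e F) \<subseteq> ?S"
    proof
      fix E assume "E \<in> cycle_edge_sets G (insert e F)"
      then obtain vs es where E: "E = set es" "is_cycle_seq G vs es" "set es \<subseteq> insert e F"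
        by (auto simp: cycle_edge_sets_def)
      show "E \<in> ?S"
      proof (cases "e \<in> set es")
        case True
        then show ?thesis
          using cycle_minus_edge_is_path[OF E(2) True E(3) uv] E(1) by auto
      next
        case False
        then have "set es \<subseteq> F"
          using E(3) by blast
        then show ?thesis
          using E(1,2) unfolding cycle_edge_sets_def by blast
      qed
    qed
    have "cycle_edge_sets G F \<subseteq> Pow F"
      by (auto simp: cycle_edge_sets_def)
    then have fin: "finite (cycle_edge_sets G F)"
      using insert.hyps finite_subset by blast
    note path = card_paths_le[OF insert.hyps(1), of "ends G"]
    have img: "card (insert e ` ?P x y) \<le> card (?P x y)" for x y
      using path by (intro card_image_le) auto
    have "card (cycle_edge_sets G (insert e F)) \<le> card ?S"
      using sub fin path by (intro card_mono) auto
    also have "\<dots> \<le> card (cycle_edge_sets G F) + (card (?P u v) + card (?P v u))"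
      by (intro order.trans[OF card_Un_le] add_mono order.refl img)
    finally have "real (card (cycle_edge_sets G (insert e F)))
        \<le> real (card (cycle_edge_sets G F)) + (real (card (?P u v)) + real (card (?P v u)))"
      by (simp flip: of_nat_add)
    also have "\<dots> \<le> 2 * (\<Sum>i<card F. root 3 3 ^ i) + (root 3 3 ^ card F + root 3 3 ^ card F)"
      using insert path by (intro add_mono) auto
    finally show ?case
      using insert.hyps by (simp add: distrib_left)
  qed
qed

text \<open>The vertices of a cycle are exactly the endpoints of its edges, so its edge set
  determines it.\<close>

lemma cycles_bij_edge_sets: "bij_betw snd (cycles G) (cycle_edge_sets G (edges G))"
proof -
  have verts: "set vs = \<Union> (ends G ` set es)" if "is_cycle_seq G vs es" for vs es
  proof -
    have k: "length es = length vs" "length vs \<ge> 2"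
      and ends: "\<And>i. i < length vs \<Longrightarrow> ends G (es ! i) = {vs ! i, vs ! (Suc i mod length vs)}"
      using that by (auto simp: is_cycle_seq_def)
    have "\<Union> (ends G ` set es) = (\<Union>i<length vs. {vs ! i, vs ! (Suc i mod length vs)})"
      using k(1) ends by (auto simp: set_conv_nth)
    also have "\<dots> = set vs"
    proof
      have "0 < length vs"
        using k(2) by linarith
      then have "Suc i mod length vs < length vs" for i
        by (simp only: mod_less_divisor)
      then show "(\<Union>i<length vs. {vs ! i, vs ! (Suc i mod length vs)}) \<subseteq> set vs"
        by auto
      show "set vs \<subseteq> (\<Union>i<length vs. {vs ! i, vs ! (Suc i mod length vs)})"
        unfolding set_conv_nth by blast
    qed
    finally show ?thesis ..
  qed
  have "inj_on snd (cycles G)"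
  proof (rule inj_onI)
    fix C D assume "C \<in> cycles G" "D \<in> cycles G" "snd C = snd D"
    then obtain vs es ws fs where "is_cycle_seq G vs es" "C = (set vs, set es)"
      "is_cycle_seq G ws fs" "D = (set ws, set fs)" "set es = set fs"
      by (auto simp: cycles_def)
    then show "C = D"
      using verts[of vs es] verts[of ws fs] by simp
  qed
  moreover have "snd ` cycles G = cycle_edge_sets G (edges G)"
  proof -
    have "is_cycle_seq G vs es \<longleftrightarrow> is_cycle_seq G vs es \<and> set es \<subseteq> edges G" for vs es
      by (auto simp: is_cycle_seq_def)
    then have "cycle_edge_sets G (edges G) = {set es | vs es. is_cycle_seq G vs es}"
      by (simp add: cycle_edge_sets_def)
    also have "\<dots> = snd ` cycles G"
      unfolding cycles_def by force
    finally show ?thesis ..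
  qed
  ultimately show ?thesis
    by (simp add: bij_betw_def)
qed

lemma num_cycles_eq: "num_cycles G = card (cycle_edge_sets G (edges G))"
  unfolding num_cycles_def by (rule bij_betw_same_card[OF cycles_bij_edge_sets])

lemma num_cycles_le:
  assumes "is_multigraph G"
  shows "real (num_cycles G) \<le> 8.25 * root 3 3 ^ card (edges G)"
proof -
  let ?r = "root 3 3" and ?m = "card (edges G)"
  note r = root_3_3_ge
  have "real (num_cycles G) \<le> 2 * (\<Sum>i<?m. ?r ^ i)"
    unfolding num_cycles_eq by (rule card_cycle_edge_sets_le[OF assms order.refl])
  also have "(\<Sum>i<?m. ?r ^ i) = (?r ^ ?m - 1) / (?r - 1)"
    using r by (intro geometric_sum) auto
  \<comment> \<open>Here 0.44 is 1.44 - 1; the resulting constant 2 / 0.44 is below 4.55.\<close>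
  also have "\<dots> \<le> ?r ^ ?m / 0.44"
    using r by (intro frac_le) auto
  also have "2 * (?r ^ ?m / 0.44) \<le> 8.25 * ?r ^ ?m"
    using r by simp
  finally show ?thesis
    by simp
qed

subsection \<open>Multigraphs with many cycles\<close>

lemma finite_cycle_edge_sets:
  assumes "is_multigraph G"
  shows "finite (cycle_edge_sets G F)"
proof -
  have "cycle_edge_sets G F \<subseteq> Pow (edges G)"
    by (auto simp: cycle_edge_sets_def is_cycle_seq_def)
  then show ?thesis
    using assms finite_subset by (fastforce simp: is_multigraph_def)
qed

text \<open>\<open>c e\<close> is the bundle of the edge \<open>e\<close>, and bundle
  \<open>i\<close> joins the vertices \<open>i\<close> and \<open>i + 1\<close> modulo
  \<open>K\<close>. Choosing one edge from each bundle gives a cycle.\<close>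

lemma ex_fat_cycle:
  fixes c :: "nat \<Rightarrow> nat"
  assumes "K \<ge> 2" "\<And>e. e < m \<Longrightarrow> c e < K"
  shows "\<exists>H :: (nat, nat) multigraph. is_multigraph H \<and> card (edges H) = m \<and>
    (\<Prod>i<K. card {e. e < m \<and> c e = i}) \<le> num_cycles H"
proof (intro exI conjI)
  let ?H = "\<lparr>verts = {..<K}, edges = {..<m}, ends = \<lambda>e. {c e, Suc (c e) mod K}\<rparr>"
  let ?A = "\<lambda>i. {e. e < m \<and> c e = i}"
  have "Suc (c e) mod K \<noteq> c e" if "e < m" for e
    using assms(2)[OF that] assms(1) by (cases "Suc (c e) = K") auto
  then show H: "is_multigraph ?H"
    using assms by (fastforce simp: is_multigraph_def card_2_iff)
  show "card (edges ?H) = m"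
    by simp
  have "(\<Prod>i<K. card (?A i)) = card (Pi\<^sub>E {..<K} ?A)"
    by (simp add: card_PiE)
  also have "\<dots> \<le> card (cycle_edge_sets ?H (edges ?H))"
  proof (rule card_inj_on_le)
    \<comment> \<open>An edge reveals its bundle through \<open>c\<close>, so the set of chosen
      edges determines the choice function.\<close>
    show "inj_on (\<lambda>f. f ` {..<K}) (Pi\<^sub>E {..<K} ?A)"
    proof (rule inj_onI)
      fix f g assume f: "f \<in> Pi\<^sub>E {..<K} ?A" and g: "g \<in> Pi\<^sub>E {..<K} ?A"
        and eq: "f ` {..<K} = g ` {..<K}"
      show "f = g"
      proof (rule PiE_ext[OF f g])
        fix i assume i: "i \<in> {..<K}"
        then obtain j where "j \<in> {..<K}" "f i = g j"
          using eq by blast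
        moreover have "c (f i) = i" "c (g j) = j"
          using f g i \<open>j \<in> {..<K}\<close> by (auto simp: PiE_iff)
        ultimately show "f i = g i"
          by simp
      qed
    qed
    show "(\<lambda>f. f ` {..<K}) ` Pi\<^sub>E {..<K} ?A \<subseteq> cycle_edge_sets ?H (edges ?H)"
    proof
      fix E assume "E \<in> (\<lambda>f. f ` {..<K}) ` Pi\<^sub>E {..<K} ?A"
      then obtain f where f: "f \<in> Pi\<^sub>E {..<K} ?A" "E = f ` {..<K}"
        by blast
      then have cf: "c (f i) = i" "f i < m" if "i < K" for i
        using that by (auto simp: PiE_iff)
      then have "inj_on f {..<K}"
        by (metis inj_onI lessThan_iff)
      then have "is_cycle_seq ?H [0..<K] (map f [0..<K])"
        using assms(1) cf by (auto simp: is_cycle_seq_def distinct_map atLeast0LessThan)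
      moreover have "set (map f [0..<K]) = E"
        using f(2) by (simp add: atLeast0LessThan)
      moreover have "E \<subseteq> edges ?H"
        using f(2) cf by auto
      ultimately show "E \<in> cycle_edge_sets ?H (edges ?H)"
        unfolding cycle_edge_sets_def by blast
    qed
  qed (rule finite_cycle_edge_sets[OF H])
  finally show "(\<Prod>i<K. card (?A i)) \<le> num_cycles ?H"
    by (simp add: num_cycles_eq)
qed

lemma ex_fat_cycle_triples:
  assumes "j \<ge> 1" "3 * j + a = m" "a \<ge> 1"
  shows "\<exists>H :: (nat, nat) multigraph. is_multigraph H \<and> card (edges H) = m \<and>
    3 ^ j * a \<le> num_cycles H"
proof -
  \<comment> \<open>Consecutive triples of edges form bundles 0 to \<open>j - 1\<close>;
    \<open>min\<close> sends the remaining \<open>a\<close> edges to bundle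
    \<open>j\<close>.\<close>
  let ?c = "\<lambda>e. min (e div 3) j"
  let ?A = "\<lambda>i. {e. e < m \<and> ?c e = i}"
  obtain H :: "(nat, nat) multigraph" where H: "is_multigraph H" "card (edges H) = m"
    and le: "(\<Prod>i<Suc j. card (?A i)) \<le> num_cycles H"
  proof -
    have "Suc j \<ge> 2" and "\<And>e. e < m \<Longrightarrow> ?c e < Suc j"
      using assms(1) by auto
    from ex_fat_cycle[where c = ?c, OF this] that show thesis
      by blast
  qed
  have "3 \<le> card (?A i)" if "i < j" for i
  proof -
    have "card {3 * i..<3 * i + 3} \<le> card (?A i)"
      using that assms by (intro card_mono) auto
    then show ?thesis
      by simp
  qed
  then have "(\<Prod>i<j. 3) \<le> (\<Prod>i<j. card (?A i))"
    by (intro prod_mono) auto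
  moreover have "card {3 * j..<m} \<le> card (?A j)"
    by (intro card_mono) auto
  then have "a \<le> card (?A j)"
    using assms(2) by simp
  ultimately have "3 ^ j * a \<le> (\<Prod>i<Suc j. card (?A i))"
    by (simp add: mult_le_mono)
  with H le show ?thesis
    using order_trans by blast
qed

text \<open>Any two of \<open>m\<close> parallel edges form a cycle.\<close>

lemma ex_dipole:
  "\<exists>H :: (nat, nat) multigraph. is_multigraph H \<and> card (edges H) = m \<and> m choose 2 \<le> num_cycles H"
proof (intro exI conjI)
  let ?H = "\<lparr>verts = {0, 1}, edges = {..<m}, ends = \<lambda>e. {0, 1}\<rparr> :: (nat, nat) multigraph"
  show H: "is_multigraph ?H"
    by (simp add: is_multigraph_def)
  show "card (edges ?H) = m"
    by simp
  have "m choose 2 = card {E. E \<subseteq> {..<m} \<and> card E = 2}"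
    by (simp add: n_subsets)
  also have "\<dots> \<le> card (cycle_edge_sets ?H (edges ?H))"
  proof (rule card_mono[OF finite_cycle_edge_sets[OF H]], rule subsetI)
    fix E assume "E \<in> {E. E \<subseteq> {..<m} \<and> card E = 2}"
    then obtain x y where E: "E = {x, y}" "x \<noteq> y" "x < m" "y < m"
      by (auto simp: card_2_iff)
    then have "is_cycle_seq ?H [0, 1] [x, y]"
      by (auto simp: is_cycle_seq_def less_Suc_eq numeral_2_eq_2)
    moreover have "E = set [x, y]" "set [x, y] \<subseteq> edges ?H"
      using E by auto
    ultimately show "E \<in> cycle_edge_sets ?H (edges ?H)"
      unfolding cycle_edge_sets_def by blast
  qed
  finally show "m choose 2 \<le> num_cycles ?H"
    by (simp add: num_cycles_eq)
qed

text \<open>With \<open>r = root 3 3\<close>, this is the bound \<open>4 * r ^ (m - 4)\<close>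
  multiplied by \<open>r ^ 4 = 3 * r\<close>, which avoids a negative exponent at
  \<open>m = 3\<close>.\<close>

lemma ex_many_cycles:
  assumes "m \<ge> 3"
  shows "\<exists>H :: (nat, nat) multigraph. is_multigraph H \<and> card (edges H) = m \<and>
    4 * root 3 3 ^ m \<le> 3 * root 3 3 * real (num_cycles H)"
proof -
  let ?r = "root 3 3"
  note bounds = root_3_3_ge root_3_3_le
  have pow3: "?r ^ (3 * j) = 3 ^ j" for j
    by (simp add: power_mult)
  have suffices: ?thesis
    if ex: "\<exists>H :: (nat, nat) multigraph. is_multigraph H \<and> card (edges H) = m \<and> N \<le> num_cycles H"
      and le: "4 * ?r ^ m \<le> 3 * ?r * real N" for N
  proof -
    from ex obtain H :: "(nat, nat) multigraph"
      where H: "is_multigraph H" "card (edges H) = m" "N \<le> num_cycles H"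
      by blast
    have "3 * ?r * real N \<le> 3 * ?r * real (num_cycles H)"
      using H(3) bounds by (intro mult_left_mono) auto
    with le have "4 * ?r ^ m \<le> 3 * ?r * real (num_cycles H)"
      by (rule order_trans)
    with H show ?thesis
      by blast
  qed
  \<comment> \<open>Cancelling \<open>3 ^ j\<close> leaves a condition on \<open>a\<close> alone:
    \<open>r \<le> 3/2\<close> for \<open>a = 2\<close>, \<open>r \<ge> 4/3\<close> for
    \<open>a = 3\<close>, and an equality for \<open>a = 4\<close>. It fails for
    \<open>a = 1\<close>, so 4 represents that residue.\<close>
  have triples: ?thesis if "j \<ge> 1" "3 * j + a = m" "a \<ge> 1" "4 * ?r ^ a \<le> 3 * ?r * real a" for j a
  proof (rule suffices[OF ex_fat_cycle_triples[OF that(1-3)]])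
    have "4 * ?r ^ m = 3 ^ j * (4 * ?r ^ a)"
      using that(2) pow3[of j] by (simp flip: that(2) add: power_add)
    also have "\<dots> \<le> 3 ^ j * (3 * ?r * real a)"
      using that(4) by (intro mult_left_mono) auto
    finally show "4 * ?r ^ m \<le> 3 * ?r * real (3 ^ j * a)"
      by (simp add: mult_ac)
  qed
  have r4: "?r ^ 4 = 3 * ?r"
    using root_3_3_cubed power_Suc[of ?r 3] by simp
  consider "m = 3" | "m = 4" | j where "j \<ge> 1" "m = 3 * j + 2" | j where "j \<ge> 1" "m = 3 * j + 3"
    | j where "j \<ge> 1" "m = 3 * j + 4"
  proof -
    assume cs: "m = 3 \<Longrightarrow> thesis" "m = 4 \<Longrightarrow> thesis"
      "\<And>j. j \<ge> 1 \<Longrightarrow> m = 3 * j + 2 \<Longrightarrow> thesis" "\<And>j. j \<ge> 1 \<Longrightarrow> m = 3 * j + 3 \<Longrightarrow> thesis"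
      "\<And>j. j \<ge> 1 \<Longrightarrow> m = 3 * j + 4 \<Longrightarrow> thesis"
    have "m = 3 \<or> m = 4 \<or> (\<exists>j\<ge>1. m = 3 * j + 2 \<or> m = 3 * j + 3 \<or> m = 3 * j + 4)"
      using assms by presburger
    then show thesis
      using cs by blast
  qed
  then show ?thesis
  proof cases
    case 1
    show ?thesis
      by (rule suffices[OF ex_dipole]) (use 1 bounds in \<open>simp add: choose_two\<close>)
  next
    case 2
    show ?thesis
      by (rule suffices[OF ex_dipole]) (use 2 bounds r4 in \<open>simp add: choose_two\<close>)
  next
    case (3 j)
    then show ?thesis
      using bounds by (intro triples[of j 2]) (auto simp: power2_eq_square)
  next
    case (4 j)
    then show ?thesis
      using bounds by (intro triples[of j 3]) auto
  next
    case (5 j)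
    then show ?thesis
      using bounds r4 by (intro triples[of j 4]) auto
  qed
qed

section \<open>Combining the lower and upper bounds for an extremal multigraph\<close>

theorem theorem5p2:
  fixes m :: nat and G :: "('v, 'e) multigraph"
  assumes "m \<ge> 3"
    and "max_cycles m G"
  shows "9 / 10 * root 3 3 ^ m < 4 * root 3 3 powi (int m - 4) \<and>
    4 * root 3 3 powi (int m - 4) \<le> real (num_cycles G) \<and>
    real (num_cycles G) \<le> 8.25 * root 3 3 ^ m"
proof -
  let ?r = "root 3 3"
  note bounds = root_3_3_ge root_3_3_le
  \<comment> \<open>The exponent is an integer because it equals -1 at \<open>m = 3\<close>.\<close>
  define x where "x = ?r powi (int m - 4)"
  have r4: "?r ^ 4 = 3 * ?r"
    using root_3_3_cubed power_Suc[of ?r 3] by simp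
  have pos: "x > 0"
    unfolding x_def using bounds by (intro zero_less_power_int) auto
  have "x * ?r powi 4 = ?r powi int m"
    unfolding x_def using bounds by (subst power_int_add[symmetric]) auto
  then have xr: "?r ^ m = 3 * ?r * x"
    using r4 by (simp add: mult_ac)
  have G: "is_multigraph G" "card (edges G) = m"
    using assms(2) by (auto simp: max_cycles_def)
  \<comment> \<open>Since \<open>?r ^ m\<close> is \<open>3 * ?r * x\<close>, the factor 9/10
    becomes 2.7, and 2.7 * 1.45 = 3.915 < 4.\<close>
  have "2.7 * ?r * x < 4 * x"
    using bounds pos by (intro mult_strict_right_mono) auto
  then have first: "9 / 10 * ?r ^ m < 4 * x"
    by (simp add: xr)
  obtain H :: "(nat, nat) multigraph" where H: "is_multigraph H" "card (edges H) = m"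
    "4 * ?r ^ m \<le> 3 * ?r * real (num_cycles H)"
    using ex_many_cycles[OF assms(1)] by blast
  \<comment> \<open>Maximality applies directly, as \<open>H\<close> has natural numbers as vertices
    and edges.\<close>
  have "num_cycles H \<le> num_cycles G"
    using assms(2) H by (auto simp: max_cycles_def)
  moreover have "(3 * ?r) * (4 * x) \<le> (3 * ?r) * real (num_cycles H)"
    using H(3) by (simp add: xr mult_ac)
  then have "4 * x \<le> real (num_cycles H)"
    using bounds by (subst (asm) mult_le_cancel_left_pos) auto
  ultimately have "4 * x \<le> real (num_cycles G)"
    by linarith
  with first num_cycles_le[OF G(1)] show ?thesis
    by (simp add: x_def G(2))
qed

end
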